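(* Let $n$ be a positive integer and let $S$ be a semigroup with exactly $n$ minimal left ideals. Then the independence number of the intersection ideal graph $\Gamma(S)$ is $\alpha(\Gamma(S))=n$.
   Context: A left ideal of a semigroup $S$ is a non-empty subset $I\subseteq S$ with $SI\subseteq I$; it is nontrivial if $I\neq S$. The intersection of two left ideals is nontrivial if it is non-empty. Minimal left ideals are understood to be nontrivial: a nontrivial left ideal is minimal if it does not properly contain any left ideal of $S$. The intersection ideal graph $\Gamma(S)$ is the simple undirected graph whose vertices are the nontrivial left ideals of $S$, with two distinct vertices $I,J$ adjacent if and only if $I\cap J$ is nontrivial. The independence number is the largest cardinality of a set of pairwise non-adjacent vertices. *)

theory Defs
  imports "Graph_Theory.Pair_Digraph" "HOL-Library.Extended_Nat"
begin

text \<open>The semigroup $S$ is the whole type \<open>'a :: semigroup_mult\<close>.\<close>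

definition left_ideal :: "'a::semigroup_mult set \<Rightarrow> bool" where
  "left_ideal I \<longleftrightarrow> I \<noteq> {} \<and> (\<forall>s. \<forall>x\<in>I. s * x \<in> I)"

definition nontrivial_left_ideal :: "'a::semigroup_mult set \<Rightarrow> bool" where
  "nontrivial_left_ideal I \<longleftrightarrow> left_ideal I \<and> I \<noteq> UNIV"

definition minimal_left_ideal :: "'a::semigroup_mult set \<Rightarrow> bool" where
  "minimal_left_ideal I \<longleftrightarrow> nontrivial_left_ideal I \<and> \<not> (\<exists>J. left_ideal J \<and> J \<subset> I)"

text \<open>
  A simple undirected graph is represented as a digraph without parallel arcs that is symmetric
  and loop-free. Note that nontriviality of an \<^emph>\<open>intersection\<close> of left ideals means only that it is
  non-empty.
\<close>

definition intersection_ideal_graph :: "'a::semigroup_mult set pair_pre_digraph" where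
  "intersection_ideal_graph =
     \<lparr> pverts = {I. nontrivial_left_ideal I},
       parcs = {(I, J). nontrivial_left_ideal I \<and> nontrivial_left_ideal J \<and>
                        I \<noteq> J \<and> I \<inter> J \<noteq> {}} \<rparr>"

lemma pair_wf_digraph_intersection_ideal_graph: "pair_wf_digraph intersection_ideal_graph"
  by unfold_locales (auto simp: intersection_ideal_graph_def)

lemma sym_intersection_ideal_graph: "sym (parcs intersection_ideal_graph)"
  by (auto simp: intersection_ideal_graph_def sym_def)

lemma irrefl_intersection_ideal_graph: "irrefl (parcs intersection_ideal_graph)"
  by (auto simp: intersection_ideal_graph_def irrefl_def)

definition independent_set :: "'v pair_pre_digraph \<Rightarrow> 'v set \<Rightarrow> bool" where
  "independent_set G A \<longleftrightarrow>
     A \<subseteq> pverts G \<and> (\<forall>u\<in>A. \<forall>v\<in>A. u \<noteq> v \<longrightarrow> (u, v) \<notin> parcs G)"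

text \<open>
  Graphs may be infinite, so cardinalities are taken in \<open>enat\<close>, all infinite ones being \<open>\<infinity>\<close>.
  A finite supremum in \<open>enat\<close> is attained (the empty set is always independent), so
  \<open>independence_number G = enat k\<close> says that \<open>k\<close> is the largest cardinality of an independent set
  and that no independent set is infinite.
\<close>

definition independence_number :: "'v pair_pre_digraph \<Rightarrow> enat" where
  "independence_number G =
     (SUP A \<in> {A. independent_set G A}. if finite A then enat (card A) else \<infinity>)"

end

(* If M is a minimal left ideal and I is any nontrivial left ideal with a in I, then M a is a minimal
   left ideal inside I. Hence choosing a minimal left ideal below each member of an independent set,
   whose members are pairwise disjoint, is injective, so such a set has at most n members. The
   minimal left ideals are themselves pairwise disjoint and attain this bound. *)

theory Submission
  imports Defs
begin

lemma minimal_left_idealD: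
  assumes "minimal_left_ideal M" "left_ideal J" "J \<subseteq> M"
  shows "J = M"
  using assms unfolding minimal_left_ideal_def by blast

lemma left_ideal_Int:
  assumes "left_ideal I" "left_ideal J" "I \<inter> J \<noteq> {}"
  shows "left_ideal (I \<inter> J)"
  using assms unfolding left_ideal_def by blast

text \<open>A common point would make the intersection a left ideal contained in both, so minimality
  would force it to equal each of them.\<close>

lemma minimal_left_ideals_disjoint:
  assumes "minimal_left_ideal M" "minimal_left_ideal N" "M \<noteq> N"
  shows "M \<inter> N = {}"
proof (rule ccontr)
  assume "M \<inter> N \<noteq> {}"
  with assms have "left_ideal (M \<inter> N)"
    by (auto intro: left_ideal_Int simp: minimal_left_ideal_def nontrivial_left_ideal_def)
  with assms show False
    by (metis inf_le1 inf_le2 minimal_left_idealD)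
qed

lemma left_ideal_right_translate:
  assumes "left_ideal M"
  shows "left_ideal ((\<lambda>m. m * a) ` M)"
  using assms unfolding left_ideal_def by (auto simp flip: mult.assoc)

text \<open>Left ideals inside the translate pull back along right multiplication by
  \<open>a\<close> to left ideals inside \<open>M\<close>, where minimality leaves only
  \<open>M\<close>. The second assumption is there because a minimal left ideal has to be
  proper.\<close>

lemma minimal_left_ideal_right_translate:
  assumes "minimal_left_ideal M" "(\<lambda>m. m * a) ` M \<noteq> UNIV"
  shows "minimal_left_ideal ((\<lambda>m. m * a) ` M)"
proof -
  have M: "left_ideal M"
    using assms by (simp add: minimal_left_ideal_def nontrivial_left_ideal_def)
  have "J = (\<lambda>m. m * a) ` M" if J: "left_ideal J" "J \<subseteq> (\<lambda>m. m * a) ` M" for J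
  proof -
    let ?K = "{m \<in> M. m * a \<in> J}"
    \<comment> \<open>Non-emptiness of \<open>?K\<close> comes from \<open>J\<close> being non-empty
      and inside the image of \<open>M\<close>; closure is associativity.\<close>
    have "left_ideal ?K"
      using M J unfolding left_ideal_def by (fastforce simp: mult.assoc)
    then have "?K = M"
      by (rule minimal_left_idealD[OF assms(1)]) auto
    with J show ?thesis by blast
  qed
  with assms M show ?thesis
    by (auto simp: minimal_left_ideal_def nontrivial_left_ideal_def left_ideal_right_translate)
qed

lemma minimal_left_ideal_below:
  fixes M I :: "'a::semigroup_mult set"
  assumes "minimal_left_ideal M" "nontrivial_left_ideal I"
  obtains N where "minimal_left_ideal N" "N \<subseteq> I"
proof -
  obtain a where "a \<in> I"
    using assms by (auto simp: nontrivial_left_ideal_def left_ideal_def)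
  then have sub: "(\<lambda>m. m * a) ` M \<subseteq> I"
    using assms by (auto simp: nontrivial_left_ideal_def left_ideal_def)
  \<comment> \<open>Properness of the translate is inherited from \<open>I\<close>.\<close>
  with assms have "(\<lambda>m. m * a) ` M \<noteq> UNIV"
    by (auto simp: nontrivial_left_ideal_def)
  with assms sub show ?thesis
    by (blast intro: that minimal_left_ideal_right_translate)
qed

lemma independent_set_intersection_ideal_graph:
  "independent_set intersection_ideal_graph A \<longleftrightarrow>
     (\<forall>I\<in>A. nontrivial_left_ideal I) \<and> (\<forall>I\<in>A. \<forall>J\<in>A. I \<noteq> J \<longrightarrow> I \<inter> J = {})"
  unfolding independent_set_def intersection_ideal_graph_def by auto

theorem theorem4p6:
  fixes n :: nat
  assumes "n > 0"
    and "card {I :: 'a::semigroup_mult set. minimal_left_ideal I} = n"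
  shows "independence_number (intersection_ideal_graph :: 'a set pair_pre_digraph) = enat n"
proof -
  let ?Min = "{I :: 'a set. minimal_left_ideal I}"
  \<comment> \<open>\<open>card\<close> is 0 on infinite sets, so \<open>n > 0\<close> excludes
    them.\<close>
  have fin: "finite ?Min"
    using assms card.infinite by fastforce
  obtain M :: "'a set" where M: "minimal_left_ideal M"
    using assms by (metis card.empty empty_Collect_eq less_irrefl)
  have upper: "finite A \<and> card A \<le> n" if A: "independent_set intersection_ideal_graph A"
    for A :: "'a set set"
  proof -
    have "\<forall>I\<in>A. \<exists>N. minimal_left_ideal N \<and> N \<subseteq> I"
      using A M by (metis independent_set_intersection_ideal_graph minimal_left_ideal_below)
    then obtain f where f: "\<forall>I\<in>A. minimal_left_ideal (f I) \<and> f I \<subseteq> I"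
      by metis
    \<comment> \<open>A shared value of \<open>f\<close> would be a non-empty subset of two disjoint
      members of \<open>A\<close>.\<close>
    have "inj_on f A"
    proof (rule inj_onI, rule ccontr)
      fix I J assume IJ: "I \<in> A" "J \<in> A" "f I = f J" "I \<noteq> J"
      then have "I \<inter> J = {}"
        using A by (simp add: independent_set_intersection_ideal_graph)
      moreover have "f I \<subseteq> I" "f I \<subseteq> J" using f IJ by auto
      moreover have "f I \<noteq> {}"
        using f IJ(1)
        by (auto simp: minimal_left_ideal_def nontrivial_left_ideal_def left_ideal_def)
      ultimately show False by blast
    qed
    moreover have "f ` A \<subseteq> ?Min" using f by auto
    ultimately show ?thesis
      using fin assms(2) by (metis card_inj_on_le inj_on_finite)
  qed
  have lower: "independent_set intersection_ideal_graph ?Min"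
    unfolding independent_set_intersection_ideal_graph
    using minimal_left_ideals_disjoint minimal_left_ideal_def by blast
  show ?thesis
    unfolding independence_number_def
  proof (rule antisym)
    \<comment> \<open>Since \<open>upper\<close> includes finiteness, the value
      \<open>\<infinity>\<close> never enters the supremum.\<close>
    show "(SUP A \<in> {A. independent_set (intersection_ideal_graph :: 'a set pair_pre_digraph) A}.
      if finite A then enat (card A) else \<infinity>) \<le> enat n"
      using upper by (auto intro!: SUP_least)
    show "enat n \<le> (SUP A \<in> {A. independent_set
      (intersection_ideal_graph :: 'a set pair_pre_digraph) A}.
      if finite A then enat (card A) else \<infinity>)"
      \<comment> \<open>The bound is attained at \<open>?Min\<close>; \<open>fin\<close> selects the
        finite branch, whose value is \<open>enat n\<close>.\<close>
      by (rule SUP_upper2[of ?Min]) (use lower fin assms(2) in auto)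
  qed
qed

end
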